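(* Let $\mathcal H$ be a real Hilbert space, $1\le p<2$, $\mathcal J:\mathcal H\to\mathbb R\cup\{+\infty\}$ absolutely $p$-homogeneous, proper, convex and lower semicontinuous, and let $u$ be the gradient flow of $\mathcal J$ with initial datum $f\in\overline{\mathrm{dom}(\mathcal J)}$ and limit $u_\infty$. If $\lambda_1>0$, then the extinction time satisfies $$T_{\mathrm{ex}}\le\frac{\|f-u_\infty\|^{2-p}}{(2-p)\lambda_1}<\infty.$$
   Context: $\mathcal J$ is absolutely $p$-homogeneous if $\mathcal J(0)=0$ and $\mathcal J(cu)=|c|^p\mathcal J(u)$ for $c\ne0$; $\mathrm{dom}(\mathcal J)=\{\mathcal J<\infty\}$; $\partial\mathcal J$ is the convex subdifferential. The null space $\mathcal N_{\mathcal J}=\{\mathcal J=0\}$ is a closed linear subspace and $\lambda_1:=\inf_{v\in\mathcal N_{\mathcal J}^\perp\setminus\{0\}}\frac{p\mathcal J(v)}{\|v\|^p}\in[0,\infty]$ (with $a/\infty:=0$ for real $a$). The gradient flow with initial datum $f\in\overline{\mathrm{dom}(\mathcal J)}$ is the unique continuous map $u:[0,\infty)\to\mathcal H$ with $u(0)=f$, Lipschitz on $[\delta,\infty)$ for all $\delta>0$, right-differentiable on $(0,\infty)$, with $-\partial_t^+u(t)$ equal to the minimal-norm element of $\partial\mathcal J(u(t))$ for all $t>0$. The limit $u_\infty:=\lim_{t\to\infty}u(t)$ exists and equals the orthogonal projection of $f$ onto $\mathcal N_{\mathcal J}$. The extinction time is $T_{\mathrm{ex}}:=\inf\{t>0:u(t)=u_\infty\}\in[0,\infty]$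 with $\inf\emptyset=\infty$. *)

theory Defs
  imports "HOL-Analysis.Analysis"
begin

text \<open>Functionals with values in the reals extended by plus infinity are functions into
  \<^typ>\<open>ereal\<close> that avoid \<open>-\<infinity>\<close>; the latter is part of \<open>proper_fun\<close>.\<close>

definition eff_dom :: "('a \<Rightarrow> ereal) \<Rightarrow> 'a set" where
  "eff_dom J = {u. J u < \<infinity>}"

definition proper_fun :: "('a \<Rightarrow> ereal) \<Rightarrow> bool" where
  "proper_fun J \<longleftrightarrow> (\<forall>u. J u \<noteq> -\<infinity>) \<and> eff_dom J \<noteq> {}"

text \<open>The library's \<^const>\<open>convex_on\<close> only covers real-valued functions. At the endpoints
  \<open>t = 0\<close> and \<open>t = 1\<close> the inequality is harmless because \<open>0 * \<infinity> = 0\<close> in \<^typ>\<open>ereal\<close>.\<close>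

definition convex_fun :: "('a::real_vector \<Rightarrow> ereal) \<Rightarrow> bool" where
  "convex_fun J \<longleftrightarrow> (\<forall>u v. \<forall>t\<in>{0..1::real}.
     J ((1 - t) *\<^sub>R u + t *\<^sub>R v) \<le> ereal (1 - t) * J u + ereal t * J v)"

definition lower_semicontinuous :: "('a::topological_space \<Rightarrow> ereal) \<Rightarrow> bool" where
  "lower_semicontinuous J \<longleftrightarrow> (\<forall>u. J u \<le> Liminf (at u) J)"

definition abs_homogeneous :: "real \<Rightarrow> ('a::real_vector \<Rightarrow> ereal) \<Rightarrow> bool" where
  "abs_homogeneous p J \<longleftrightarrow>
     J 0 = 0 \<and> (\<forall>c u. c \<noteq> 0 \<longrightarrow> J (c *\<^sub>R u) = ereal (\<bar>c\<bar> powr p) * J u)"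

definition subdifferential :: "('a::real_inner \<Rightarrow> ereal) \<Rightarrow> 'a \<Rightarrow> 'a set" where
  "subdifferential J u = {z. \<forall>v. J u + ereal (z \<bullet> (v - u)) \<le> J v}"

definition null_space :: "('a \<Rightarrow> ereal) \<Rightarrow> 'a set" where
  "null_space J = {u. J u = 0}"

text \<open>If the orthogonal complement of the null space is trivial, the infimum is \<open>\<infinity>\<close>.\<close>

definition lambda1 :: "real \<Rightarrow> ('a::real_inner \<Rightarrow> ereal) \<Rightarrow> ereal" where
  "lambda1 p J =
     (INF v \<in> orthogonal_comp (null_space J) - {0}. ereal p * J v / ereal (norm v powr p))"

text \<open>A map on \<open>[0,\<infinity>)\<close> is a function on \<^typ>\<open>real\<close> whose values at negative arguments
  are irrelevant.\<close>

definition gradient_flow :: "('a::real_inner \<Rightarrow> ereal) \<Rightarrow> 'a \<Rightarrow> (real \<Rightarrow> 'a) \<Rightarrow> bool" where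
  "gradient_flow J f u \<longleftrightarrow>
     continuous_on {0..} u \<and> u 0 = f \<and>
     (\<forall>\<delta>>0. \<exists>L. L-lipschitz_on {\<delta>..} u) \<and>
     (\<forall>t>0. \<exists>d. (u has_vector_derivative d) (at_right t) \<and>
               is_arg_min norm (\<lambda>z. z \<in> subdifferential J (u t)) (- d))"

definition flow_limit :: "(real \<Rightarrow> 'a::real_inner) \<Rightarrow> 'a" where
  "flow_limit u = Lim at_top u"

definition extinction_time :: "(real \<Rightarrow> 'a::real_inner) \<Rightarrow> ereal" where
  "extinction_time u = Inf (ereal ` {t. t > 0 \<and> u t = flow_limit u})"

end

theory Submission
  imports Defs
begin

text \<open>
  Split the initial datum as \<open>f = q + (f - q)\<close> with \<open>q\<close> in the null space \<open>N\<close> and \<open>f - q\<close>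
  orthogonal to it. Homogeneity and convexity make \<open>J\<close> invariant under translations by \<open>N\<close>, so
  subgradients are orthogonal to \<open>N\<close> (\<open>subdifferential_orthogonal_null_space\<close>) and the flow never
  moves in the direction of \<open>N\<close>: the remainder \<open>w t = u t - q\<close> stays in the orthogonal complement,
  where \<open>lambda1\<close> controls \<open>J\<close> from below (\<open>gradient_flow_projection\<close>).

  Euler's identity \<open>z \<bullet> u = p J(u)\<close> for subgradients (\<open>subdifferential_euler\<close>) turns the flow
  equation into an energy identity: the right derivative of \<open>\<parallel>w\<parallel>\<^sup>2 / 2\<close> is \<open>- p J(w)\<close>, which is at
  most \<open>- \<lambda> \<parallel>w\<parallel>\<^sup>p\<close> for every real \<open>\<lambda> > 0\<close> with \<open>\<lambda> \<le> lambda1\<close>. Since \<open>p < 2\<close>, this inequality says that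
  \<open>\<parallel>w\<parallel>\<^sup>2\<^sup>-\<^sup>p\<close> decreases at rate at least \<open>(2 - p) \<lambda>\<close> as long as \<open>w\<close> does not vanish. A nonnegative
  quantity cannot do so beyond the time \<open>\<parallel>f - q\<parallel>\<^sup>2\<^sup>-\<^sup>p / ((2 - p) \<lambda>)\<close>, hence \<open>u\<close> equals \<open>q\<close> from then
  on (\<open>gradient_flow_extinct\<close>). In particular \<open>q\<close> is the limit of the flow, and the bound holds with
  \<open>\<lambda> = lambda1\<close>, or for arbitrarily large \<open>\<lambda>\<close> if \<open>lambda1\<close> is infinite.
\<close>

section \<open>Convex homogeneous functionals and their null space\<close>

lemma abs_homogeneous_minus:
  assumes "abs_homogeneous p J" shows "J (- u) = J u"
proof -
  have "J ((-1) *\<^sub>R u) = ereal (\<bar>-1\<bar> powr p) * J u"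
    using assms unfolding abs_homogeneous_def by (metis zero_neq_neg_one)
  then show ?thesis by simp
qed

text \<open>The origin is the midpoint of \<open>u\<close> and \<open>- u\<close>, where \<open>J\<close> takes the same value.\<close>

lemma abs_homogeneous_nonneg:
  assumes "abs_homogeneous p J" "convex_fun J" shows "0 \<le> J u"
proof -
  have "J ((1 - 1/2) *\<^sub>R u + (1/2) *\<^sub>R (- u)) \<le> ereal (1 - 1/2) * J u + ereal (1/2) * J (- u)"
    by (rule assms(2)[unfolded convex_fun_def, rule_format]) simp
  then have "J 0 \<le> ereal (1/2) * J u + ereal (1/2) * J u"
    using assms(1) by (simp add: abs_homogeneous_minus)
  moreover have "J 0 = 0" using assms(1) by (simp add: abs_homogeneous_def)
  ultimately show ?thesis by (cases "J u") (auto simp flip: zero_ereal_def)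
qed

lemma subspace_null_space:
  assumes "abs_homogeneous p J" "convex_fun J" shows "subspace (null_space J)"
proof -
  have sc: "J (c *\<^sub>R x) = 0" if "J x = 0" for c x
    using assms(1) that by (cases "c = 0") (simp_all add: abs_homogeneous_def)
  have "J (x + y) = 0" if "J x = 0" "J y = 0" for x y
  proof -
    have "J ((1 - 1/2) *\<^sub>R (2 *\<^sub>R x) + (1/2) *\<^sub>R (2 *\<^sub>R y))
        \<le> ereal (1 - 1/2) * J (2 *\<^sub>R x) + ereal (1/2) * J (2 *\<^sub>R y)"
      by (rule assms(2)[unfolded convex_fun_def, rule_format]) simp
    then have "J (x + y) \<le> 0" by (simp add: sc that)
    then show ?thesis using abs_homogeneous_nonneg[OF assms] by (simp add: antisym)
  qed
  then show ?thesis
    using sc assms(1) by (auto simp: subspace_def null_space_def abs_homogeneous_def)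
qed

lemma closed_null_space:
  assumes "lower_semicontinuous J" "\<And>u. 0 \<le> J u" shows "closed (null_space J)"
  unfolding closed_limpt
proof (intro allI impI)
  fix x assume x: "x islimpt null_space J"
  have "\<not> 0 < Liminf (at x) J"
  proof
    assume "0 < Liminf (at x) J"
    then have "eventually (\<lambda>y. 0 < J y) (at x)" by (rule less_LiminfD)
    then have "eventually (\<lambda>y. y \<notin> null_space J) (at x)"
      by eventually_elim (simp add: null_space_def)
    with x show False by (simp add: islimpt_iff_eventually)
  qed
  then have "J x \<le> 0"
    using assms(1) by (meson lower_semicontinuous_def not_le_imp_less order.trans)
  then show "x \<in> null_space J"
    using assms(2)[of x] by (simp add: null_space_def antisym)
qed

text \<open>Write \<open>u + n\<close> as a convex combination of \<open>u / (1 - t)\<close> and \<open>n / t\<close>. The second point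
  contributes nothing to the convexity bound, and the contribution of the first tends to \<open>J u\<close>
  as \<open>t\<close> tends to \<open>0\<close>.\<close>

lemma null_space_translate_le:
  assumes "abs_homogeneous p J" "convex_fun J" "n \<in> null_space J"
  shows "J (u + n) \<le> J u"
proof (cases "J u")
  case (real j)
  have bound: "J (u + n) \<le> ereal ((1 - t) * ((1 / (1 - t)) powr p * j))" if "0 < t" "t < 1" for t
  proof -
    have "J ((1 / t) *\<^sub>R n) = 0"
      using subspace_scale[OF subspace_null_space[OF assms(1,2)] assms(3), of "1 / t"]
      by (simp add: null_space_def)
    moreover have "J ((1 / (1 - t)) *\<^sub>R u) = ereal ((1 / (1 - t)) powr p) * ereal j"
      using assms(1) that real by (simp add: abs_homogeneous_def)
    moreover have "J ((1 - t) *\<^sub>R ((1 / (1 - t)) *\<^sub>R u) + t *\<^sub>R ((1 / t) *\<^sub>R n))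
        \<le> ereal (1 - t) * J ((1 / (1 - t)) *\<^sub>R u) + ereal t * J ((1 / t) *\<^sub>R n)"
      by (rule assms(2)[unfolded convex_fun_def, rule_format]) (use that in simp)
    ultimately show ?thesis using that by simp
  qed
  have "((\<lambda>t. (1 - t) * ((1 / (1 - t)) powr p * j)) \<longlongrightarrow> (1 - 0) * ((1 / (1 - 0)) powr p * j))
      (at_right (0::real))"
    by (intro tendsto_intros) simp_all
  then have "((\<lambda>t. ereal ((1 - t) * ((1 / (1 - t)) powr p * j))) \<longlongrightarrow> ereal j) (at_right (0::real))"
    by simp
  moreover have "eventually (\<lambda>t. J (u + n) \<le> ereal ((1 - t) * ((1 / (1 - t)) powr p * j)))
      (at_right (0::real))"
    using eventually_at_right_real[of 0 "1::real", OF zero_less_one]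
    by eventually_elim (use bound in auto)
  ultimately show ?thesis
    unfolding real by (rule tendsto_lowerbound) simp
qed (use abs_homogeneous_nonneg[OF assms(1,2), of u] in auto)

lemma null_space_translate:
  assumes "abs_homogeneous p J" "convex_fun J" "n \<in> null_space J"
  shows "J (u + n) = J u"
proof (rule antisym)
  have "- n \<in> null_space J"
    using subspace_neg[OF subspace_null_space[OF assms(1,2)] assms(3)] .
  then show "J u \<le> J (u + n)"
    using null_space_translate_le[OF assms(1,2), of "- n" "u + n"] by simp
qed (rule null_space_translate_le[OF assms])

section \<open>Subgradients of homogeneous functionals\<close>

text \<open>The subgradient inequality tested at the origin bounds \<open>J u\<close> from above.\<close>

lemma subdifferential_finite:
  assumes "abs_homogeneous p J" "convex_fun J" "z \<in> subdifferential J u"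
  obtains j where "J u = ereal j"
proof -
  have "J u + ereal (z \<bullet> (0 - u)) \<le> J 0"
    using assms(3) unfolding subdifferential_def by blast
  moreover have "J 0 = 0" using assms(1) by (simp add: abs_homogeneous_def)
  ultimately have "J u + ereal (z \<bullet> (0 - u)) \<le> 0" by simp
  then show ?thesis
    using that abs_homogeneous_nonneg[OF assms(1,2), of u] by (cases "J u") auto
qed

text \<open>Euler's identity: along the ray through \<open>u\<close> the subgradient inequality says that
  \<open>c \<mapsto> c\<^sup>p J(u) - (c - 1) (z \<bullet> u)\<close> is minimal at \<open>c = 1\<close>, so its derivative there
  vanishes.\<close>

lemma subdifferential_euler:
  assumes "abs_homogeneous p J" "convex_fun J" "z \<in> subdifferential J u"
    and j: "J u = ereal j"
  shows "z \<bullet> u = p * j"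
proof -
  let ?g = "\<lambda>c::real. c powr p * j - (c - 1) * (z \<bullet> u)"
  have min: "?g 1 \<le> ?g c" if "0 < c" for c
  proof -
    have "J u + ereal (z \<bullet> (c *\<^sub>R u - u)) \<le> J (c *\<^sub>R u)"
      using assms(3) by (simp add: subdifferential_def)
    also have "J (c *\<^sub>R u) = ereal (c powr p * j)"
      using assms(1) that j by (simp add: abs_homogeneous_def)
    finally show ?thesis using j by (simp add: inner_diff_right algebra_simps)
  qed
  have "DERIV ?g 1 :> p * j - z \<bullet> u"
    by (auto intro!: derivative_eq_intros)
  then have "p * j - z \<bullet> u = 0"
    by (rule DERIV_local_min[where d = 1]) (use min in \<open>auto simp: abs_if split: if_splits\<close>)
  then show ?thesis by simp
qed

text \<open>Moving along the null space does not change \<open>J\<close>, so the linear minorant given by a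
  subgradient cannot grow in any of these directions.\<close>

lemma subdifferential_orthogonal_null_space:
  assumes "abs_homogeneous p J" "convex_fun J" "z \<in> subdifferential J u" "n \<in> null_space J"
  shows "z \<bullet> n = 0"
proof -
  obtain j where j: "J u = ereal j" using subdifferential_finite[OF assms(1-3)] .
  have le: "z \<bullet> m \<le> 0" if "m \<in> null_space J" for m
  proof -
    have "J u + ereal (z \<bullet> ((u + m) - u)) \<le> J (u + m)"
      using assms(3) unfolding subdifferential_def by blast
    then show ?thesis using j null_space_translate[OF assms(1,2) that, of u] by simp
  qed
  have "- n \<in> null_space J"
    using subspace_neg[OF subspace_null_space[OF assms(1,2)] assms(4)] .
  then show ?thesis using le[OF assms(4)] le[of "- n"] by simp
qed

section \<open>Orthogonal projection in a Hilbert space\<close>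

text \<open>A sequence in \<open>S\<close> that minimises the distance to \<open>f\<close> is Cauchy by the parallelogram law, as
  midpoints of its members stay in \<open>S\<close>. Its limit is a closest point, and varying it along a
  line in \<open>S\<close> shows that the difference to \<open>f\<close> is orthogonal to \<open>S\<close>.\<close>

lemma hilbert_projection:
  fixes S :: "'a::{real_inner, complete_space} set"
  assumes "subspace S" "closed S"
  obtains q where "q \<in> S" "f - q \<in> orthogonal_comp S"
proof -
  define d where "d = (INF s\<in>S. (norm (f - s))\<^sup>2)"
  have ne: "S \<noteq> {}" using assms(1) subspace_0 by blast
  have bdd: "bdd_below ((\<lambda>s. (norm (f - s))\<^sup>2) ` S)" by (rule bdd_belowI2[of _ 0]) simp
  have d_le: "d \<le> (norm (f - s))\<^sup>2" if "s \<in> S" for s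
    unfolding d_def using bdd that by (rule cINF_lower)
  have "\<exists>s\<in>S. (norm (f - s))\<^sup>2 < d + 1 / real (Suc k)" for k
  proof -
    have "d < d + 1 / real (Suc k)" by simp
    then show ?thesis unfolding d_def using cINF_less_iff[OF ne bdd] by blast
  qed
  then obtain s where s: "\<And>k. s k \<in> S" "\<And>k. (norm (f - s k))\<^sup>2 < d + 1 / real (Suc k)"
    by metis
  have close: "(norm (s m - s n))\<^sup>2 \<le> 2 / real (Suc m) + 2 / real (Suc n)" for m n
  proof -
    let ?a = "f - s m" and ?b = "f - s n"
    have mid: "(1/2) *\<^sub>R (s m + s n) \<in> S"
      using assms(1) s(1) by (intro subspace_scale subspace_add)
    have "(norm (?a - ?b))\<^sup>2 + 4 * (norm (f - (1/2) *\<^sub>R (s m + s n)))\<^sup>2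
        = 2 * (norm ?a)\<^sup>2 + 2 * (norm ?b)\<^sup>2"
      by (simp add: power2_norm_eq_inner inner_diff inner_add inner_commute algebra_simps)
    moreover have "norm (?a - ?b) = norm (s m - s n)" by (simp add: norm_minus_commute)
    ultimately show ?thesis using d_le[OF mid] s(2)[of m] s(2)[of n] by (simp add: algebra_simps)
  qed
  have "Cauchy s"
  proof (rule metric_CauchyI)
    fix e :: real assume "0 < e"
    obtain M where M: "inverse (real (Suc M)) < e\<^sup>2 / 4"
      using reals_Archimedean[of "e\<^sup>2 / 4"] \<open>0 < e\<close> by auto
    have "dist (s m) (s n) < e" if "m \<ge> M" "n \<ge> M" for m n
    proof -
      have "1 / real (Suc m) \<le> 1 / real (Suc M)" "1 / real (Suc n) \<le> 1 / real (Suc M)"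
        using that by (auto intro!: divide_left_mono)
      then have "(norm (s m - s n))\<^sup>2 < e\<^sup>2"
        using close[of m n] M by (simp add: inverse_eq_divide)
      then show ?thesis using \<open>0 < e\<close> by (simp add: dist_norm power_less_imp_less_base)
    qed
    then show "\<exists>M. \<forall>m\<ge>M. \<forall>n\<ge>M. dist (s m) (s n) < e" by blast
  qed
  then obtain q where lim: "s \<longlonglongrightarrow> q" using Cauchy_convergent convergent_def by blast
  have q: "q \<in> S" using closed_sequentially[OF assms(2) s(1) lim] .
  have "(norm (f - q))\<^sup>2 \<le> d"
  proof (rule LIMSEQ_le)
    show "(\<lambda>k. (norm (f - s k))\<^sup>2) \<longlonglongrightarrow> (norm (f - q))\<^sup>2" by (intro tendsto_intros lim)
    show "(\<lambda>k. d + 1 / real (Suc k)) \<longlonglongrightarrow> d"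
      using tendsto_add[OF tendsto_const LIMSEQ_inverse_real_of_nat, of d]
      by (simp add: inverse_eq_divide)
    show "\<exists>N. \<forall>n\<ge>N. (norm (f - s n))\<^sup>2 \<le> d + 1 / real (Suc n)" using s(2) less_imp_le by blast
  qed
  then have best: "(norm (f - q))\<^sup>2 \<le> (norm (f - x))\<^sup>2" if "x \<in> S" for x
    using d_le[OF that] by linarith
  have "orthogonal y (f - q)" if "y \<in> S" for y
  proof -
    let ?g = "\<lambda>c::real. (f - q - c *\<^sub>R y) \<bullet> (f - q - c *\<^sub>R y)"
    have "?g 0 \<le> ?g c" for c
      using best[of "q + c *\<^sub>R y"] q that assms(1)
      by (simp add: subspace_add subspace_scale power2_norm_eq_inner diff_diff_add)
    moreover have "DERIV ?g 0 :> - 2 * (y \<bullet> (f - q))"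
    proof -
      have "?g = (\<lambda>c. (f - q) \<bullet> (f - q) - 2 * c * (y \<bullet> (f - q)) + c\<^sup>2 * (y \<bullet> y))"
        by (rule ext) (simp add: inner_diff inner_commute power2_eq_square algebra_simps)
      then show ?thesis by (auto intro!: derivative_eq_intros)
    qed
    ultimately have "- 2 * (y \<bullet> (f - q)) = 0" by (intro DERIV_local_min[where d = 1]) auto
    then show ?thesis by (simp add: orthogonal_def)
  qed
  then show ?thesis using that q by (auto simp: orthogonal_comp_def)
qed

section \<open>Monotonicity from right derivatives\<close>

text \<open>A gradient flow is only known to be differentiable from the right, so the mean value theorem
  does not apply. Instead, fix a slope \<open>e > 0\<close> and a starting point \<open>c\<close>: the last point where \<open>g\<close>
  is not above the line of slope \<open>e\<close> through \<open>(c, g c)\<close> cannot lie before \<open>b\<close>, because by the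
  right derivative there \<open>g\<close> stays below the line a little longer. The start \<open>c\<close> has to be an interior
  point because nothing is known about the derivative at \<open>a\<close>; continuity then gives the claim
  for \<open>c = a\<close>.\<close>

lemma right_derivative_nonpos_imp_le:
  fixes g :: "real \<Rightarrow> real"
  assumes "a \<le> b" and cont: "continuous_on {a..b} g"
    and deriv: "\<And>t. a < t \<Longrightarrow> t < b \<Longrightarrow> \<exists>D\<le>0. (g has_vector_derivative D) (at_right t)"
  shows "g b \<le> g a"
proof -
  have slope: "g b \<le> g c + e * (b - c)" if c: "a < c" "c \<le> b" and e: "0 < e" for c e
  proof -
    define A where "A = {t \<in> {c..b}. g t - e * t \<le> g c - e * c}"
    have "closed A" unfolding A_def
      by (intro continuous_on_closed_Collect_le continuous_intros continuous_on_subset[OF cont])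
        (use c in auto)
    have A: "c \<in> A" "A \<subseteq> {c..b}" using c by (auto simp: A_def)
    then have bdd: "bdd_above A" by (meson bdd_above_Icc bdd_above_mono)
    define s where "s = Sup A"
    have sA: "s \<in> A" unfolding s_def using \<open>closed A\<close> A bdd by (intro closed_contains_Sup) auto
    have "s = b"
    proof (rule ccontr)
      assume "s \<noteq> b"
      then have s: "a < s" "s < b" using sA A c by (auto simp: subset_iff)
      obtain D where D: "D \<le> 0" "(g has_vector_derivative D) (at_right s)"
        using deriv[OF s] by blast
      have "((\<lambda>t. (g t - g s) / (t - s)) \<longlongrightarrow> D) (at_right s)"
        using D(2) by (simp add: has_field_derivative_iff
            flip: has_real_derivative_iff_has_vector_derivative)
      then have "eventually (\<lambda>t. (g t - g s) / (t - s) < e) (at_right s)"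
        by (rule order_tendstoD) (use D(1) e in simp)
      moreover have "eventually (\<lambda>t. t \<in> {s<..<b}) (at_right s)"
        using s by (intro eventually_at_right_real)
      ultimately have "eventually (\<lambda>t. (g t - g s) / (t - s) < e \<and> t \<in> {s<..<b}) (at_right s)"
        by (rule eventually_conj)
      then obtain t where t: "(g t - g s) / (t - s) < e" "s < t" "t < b"
        using eventually_happens'[OF trivial_limit_at_right_real] by fastforce
      then have "g t - g s < e * (t - s)" by (simp add: pos_divide_less_eq)
      then have "t \<in> A" using sA t by (auto simp: A_def algebra_simps)
      then have "t \<le> s" unfolding s_def using bdd by (rule cSup_upper)
      with t show False by simp
    qed
    then show ?thesis using sA by (simp add: A_def algebra_simps)
  qed
  have interior: "g b \<le> g c" if "a < c" "c \<le> b" for c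
  proof (rule field_le_epsilon)
    fix e :: real assume "0 < e"
    show "g b \<le> g c + e"
    proof (cases "c = b")
      case False
      then show ?thesis using slope[OF that, of "e / (b - c)"] that \<open>0 < e\<close> by simp
    qed (use \<open>0 < e\<close> in simp)
  qed
  show ?thesis
  proof (cases "a = b")
    case False
    then have ab: "a < b" using assms(1) by simp
    have "(g \<longlongrightarrow> g a) (at_right a)"
      using cont ab by (auto simp: continuous_on_Icc_at_rightD)
    moreover have "eventually (\<lambda>c. g b \<le> g c) (at_right a)"
      using eventually_at_right_real[OF ab] by eventually_elim (use interior in auto)
    ultimately show ?thesis by (rule tendsto_lowerbound) simp
  qed simp
qed

section \<open>Decay of the gradient flow\<close>

text \<open>For \<open>n\<close> in the null space, \<open>u \<bullet> n\<close> has right derivative zero by orthogonality of the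
  subgradients. The one-sided monotonicity principle applied to \<open>n\<close> and \<open>- n\<close> shows that it
  keeps its initial value \<open>f \<bullet> n\<close>.\<close>

lemma gradient_flow_projection:
  assumes "abs_homogeneous p J" "convex_fun J" "gradient_flow J f u"
    and "f - q \<in> orthogonal_comp (null_space J)" "0 \<le> t"
  shows "u t - q \<in> orthogonal_comp (null_space J)"
proof -
  have cont: "continuous_on {0..t} u" and u0: "u 0 = f"
    using assms(3) by (auto simp: gradient_flow_def intro: continuous_on_subset)
  have le: "u t \<bullet> n \<le> f \<bullet> n" if n: "n \<in> null_space J" for n
  proof -
    have "u t \<bullet> n \<le> u 0 \<bullet> n"
    proof (rule right_derivative_nonpos_imp_le[OF assms(5)])
      show "continuous_on {0..t} (\<lambda>s. u s \<bullet> n)" by (intro continuous_intros cont)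
      fix s :: real assume "0 < s" "s < t"
      then obtain d where d: "(u has_vector_derivative d) (at_right s)" "- d \<in> subdifferential J (u s)"
        using assms(3) by (auto simp: gradient_flow_def is_arg_min_def)
      have "((\<lambda>s. u s \<bullet> n) has_vector_derivative d \<bullet> n) (at_right s)"
        using bounded_linear.has_vector_derivative[OF bounded_linear_inner_left d(1)] .
      moreover have "d \<bullet> n = 0"
        using subdifferential_orthogonal_null_space[OF assms(1,2) d(2) n] by simp
      ultimately show "\<exists>D\<le>0. ((\<lambda>s. u s \<bullet> n) has_vector_derivative D) (at_right s)" by auto
    qed
    then show ?thesis by (simp add: u0)
  qed
  have "n \<bullet> (u t - q) = 0" if n: "n \<in> null_space J" for n
  proof -
    have "- n \<in> null_space J"
      using subspace_neg[OF subspace_null_space[OF assms(1,2)] n] .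
    from le[OF n] le[OF this] have "u t \<bullet> n = f \<bullet> n" by simp
    moreover have "n \<bullet> (f - q) = 0"
      using assms(4) n by (auto simp: orthogonal_comp_def orthogonal_def)
    ultimately show ?thesis by (simp add: inner_diff_right inner_commute)
  qed
  then show ?thesis by (auto simp: orthogonal_comp_def orthogonal_def)
qed

text \<open>The energy identity: \<open>d \<bullet> (u t - q)\<close> is the right derivative of \<open>\<parallel>u - q\<parallel>\<^sup>2 / 2\<close>, and
  Euler's identity evaluates it because subgradients do not see \<open>q\<close>.\<close>

lemma gradient_flow_energy:
  assumes "abs_homogeneous p J" "convex_fun J" "gradient_flow J f u"
    and "q \<in> null_space J" "0 < t"
  obtains d j where "(u has_vector_derivative d) (at_right t)" "J (u t - q) = ereal j" "0 \<le> j"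
    "d \<bullet> (u t - q) = - p * j"
proof -
  obtain d where d: "(u has_vector_derivative d) (at_right t)" "- d \<in> subdifferential J (u t)"
    using assms(3,5) by (auto simp: gradient_flow_def is_arg_min_def)
  obtain j where j: "J (u t) = ereal j"
    using subdifferential_finite[OF assms(1,2) d(2)] .
  have "- d \<bullet> u t = p * j" using subdifferential_euler[OF assms(1,2) d(2) j] .
  moreover have "- d \<bullet> q = 0"
    using subdifferential_orthogonal_null_space[OF assms(1,2) d(2) assms(4)] .
  ultimately have "d \<bullet> (u t - q) = - p * j" by (simp add: inner_diff_right)
  moreover have "J (u t - q) = ereal j"
    using null_space_translate[OF assms(1,2,4), of "u t - q"] j by simp
  moreover have "0 \<le> j" using abs_homogeneous_nonneg[OF assms(1,2), of "u t"] j by simp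
  ultimately show ?thesis using that d(1) by blast
qed

lemma gradient_flow_dist_antimono:
  assumes "0 \<le> p" "abs_homogeneous p J" "convex_fun J" "gradient_flow J f u"
    and "q \<in> null_space J" "0 \<le> s" "s \<le> t"
  shows "norm (u t - q) \<le> norm (u s - q)"
proof -
  have "(u t - q) \<bullet> (u t - q) \<le> (u s - q) \<bullet> (u s - q)"
  proof (rule right_derivative_nonpos_imp_le[OF assms(7)])
    show "continuous_on {s..t} (\<lambda>r. (u r - q) \<bullet> (u r - q))"
      using assms(4,6) by (auto simp: gradient_flow_def intro!: continuous_intros
          intro: continuous_on_subset)
    fix r assume "s < r" "r < t"
    then have "0 < r" using assms(6) by simp
    then obtain d j where d: "(u has_vector_derivative d) (at_right r)" "0 \<le> j"
        "d \<bullet> (u r - q) = - p * j"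
      using gradient_flow_energy[OF assms(2-5)] by metis
    have "((\<lambda>r. u r - q) has_vector_derivative d) (at_right r)"
      using d(1) by (auto intro!: derivative_eq_intros)
    then have "((\<lambda>r. (u r - q) \<bullet> (u r - q)) has_vector_derivative
        (u r - q) \<bullet> d + d \<bullet> (u r - q)) (at_right r)"
      by (intro bounded_bilinear.has_vector_derivative[OF bounded_bilinear_inner])
    moreover have "(u r - q) \<bullet> d + d \<bullet> (u r - q) \<le> 0"
      using d(2,3) assms(1) by (simp add: inner_commute)
    ultimately show "\<exists>D\<le>0. ((\<lambda>r. (u r - q) \<bullet> (u r - q)) has_vector_derivative D) (at_right r)"
      by blast
  qed
  then show ?thesis by (simp add: norm_le)
qed

lemma lambda1_le:
  assumes "ereal l \<le> lambda1 p J" "w \<in> orthogonal_comp (null_space J)" "w \<noteq> 0" "J w = ereal j"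
  shows "l * norm w powr p \<le> p * j"
proof -
  have "lambda1 p J \<le> ereal p * J w / ereal (norm w powr p)"
    unfolding lambda1_def using assms(2,3) by (intro INF_lower) auto
  then have "ereal l \<le> ereal (p * j / norm w powr p)"
    using order.trans[OF assms(1), of "ereal (p * j / norm w powr p)"] assms(3,4) by simp
  then show ?thesis using assms(3) by (simp add: field_simps)
qed

text \<open>If \<open>u t\<close> were different from \<open>q\<close>, then \<open>u - q\<close> would have no zero in \<open>[0,t]\<close>, as its norm
  is nonincreasing. On this interval \<open>\<parallel>u - q\<parallel>\<^sup>2\<^sup>-\<^sup>p\<close> may therefore be differentiated, and by the energy
  identity and the eigenvalue bound its slope is at most \<open>- (2 - p) l\<close>; so it would have reached
  zero by time \<open>t\<close>.\<close>

lemma gradient_flow_extinct: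
  assumes p: "0 \<le> p" "p < 2"
    and J: "abs_homogeneous p J" "convex_fun J" and flow: "gradient_flow J f u"
    and q: "q \<in> null_space J" "f - q \<in> orthogonal_comp (null_space J)"
    and l: "ereal l \<le> lambda1 p J"
    and t: "0 \<le> t" "norm (f - q) powr (2 - p) \<le> (2 - p) * l * t"
  shows "u t = q"
proof (rule ccontr)
  assume neq: "u t \<noteq> q"
  define w where "w = (\<lambda>s. u s - q)"
  \<comment> \<open>The first summand is \<open>\<parallel>w s\<parallel>\<^sup>2\<^sup>-\<^sup>p\<close>; the inner product, unlike the norm, is covered by the
    product rule for right derivatives.\<close>
  let ?g = "\<lambda>s. (w s \<bullet> w s) powr ((2 - p) / 2) + (2 - p) * l * s"
  have w0: "w s \<noteq> 0" if "0 \<le> s" "s \<le> t" for s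
    using gradient_flow_dist_antimono[OF p(1) J flow q(1) that] neq by (auto simp: w_def)
  have ww: "(w s \<bullet> w s) powr (x / 2) = norm (w s) powr x" for s x
    by (simp add: power2_norm_eq_inner[symmetric] powr_powr flip: powr_numeral)
  have "?g t \<le> ?g 0"
  proof (rule right_derivative_nonpos_imp_le[OF t(1)])
    have "continuous_on {0..t} w" unfolding w_def
      using flow by (auto simp: gradient_flow_def intro!: continuous_intros intro: continuous_on_subset)
    then show "continuous_on {0..t} ?g"
      by (intro continuous_intros) (use w0 in auto)
    fix s assume s: "0 < s" "s < t"
    then obtain d j where d: "(u has_vector_derivative d) (at_right s)" "J (w s) = ereal j"
        "d \<bullet> w s = - p * j"
      using gradient_flow_energy[OF J flow q(1)] unfolding w_def by metis
    have ws: "w s \<noteq> 0" using w0 s by simp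
    have "(w has_vector_derivative d) (at_right s)"
      unfolding w_def using d(1) by (auto intro!: derivative_eq_intros)
    then have "((\<lambda>s. w s \<bullet> w s) has_vector_derivative w s \<bullet> d + d \<bullet> w s) (at_right s)"
      by (intro bounded_bilinear.has_vector_derivative[OF bounded_bilinear_inner])
    then have deriv: "((\<lambda>s. w s \<bullet> w s) has_real_derivative - 2 * (p * j)) (at_right s)"
      using d(3) by (simp add: has_real_derivative_iff_has_vector_derivative inner_commute mult.commute)
    let ?D = "(2 - p) * (l - norm (w s) powr - p * (p * j))"
    have "((\<lambda>x. x powr ((2 - p) / 2)) has_real_derivative
        (2 - p) / 2 * (w s \<bullet> w s) powr ((2 - p) / 2 - 1)) (at (w s \<bullet> w s))"
      using ws by (intro has_real_derivative_powr) simp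
    from DERIV_add[OF DERIV_chain2[OF this deriv] DERIV_cmult[OF DERIV_ident, of "(2 - p) * l"]]
    have "(?g has_real_derivative (2 - p) / 2 * (w s \<bullet> w s) powr ((2 - p) / 2 - 1) * (- 2 * (p * j))
        + (2 - p) * l) (at_right s)"
      by simp
    moreover have "(2 - p) / 2 * (w s \<bullet> w s) powr ((2 - p) / 2 - 1) * (- 2 * (p * j)) + (2 - p) * l
        = ?D"
    proof -
      have "(2 - p) / 2 - 1 = (- p) / 2" by (simp add: field_simps)
      then have "(w s \<bullet> w s) powr ((2 - p) / 2 - 1) = norm (w s) powr - p" by (simp only: ww)
      then show ?thesis by (simp add: algebra_simps add_divide_distrib diff_divide_distrib)
    qed
    ultimately have "(?g has_real_derivative ?D) (at_right s)" by (simp only:)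
    moreover have "?D \<le> 0"
    proof -
      have "l * norm (w s) powr p \<le> p * j"
      proof (rule lambda1_le[OF l _ ws d(2)])
        show "w s \<in> orthogonal_comp (null_space J)"
          unfolding w_def using gradient_flow_projection[OF J flow q(2)] s by simp
      qed
      then have "l \<le> norm (w s) powr - p * (p * j)"
        using ws by (simp add: powr_minus field_simps)
      then show ?thesis using p(2) by (simp add: mult_nonneg_nonpos)
    qed
    ultimately show "\<exists>D\<le>0. (?g has_vector_derivative D) (at_right s)"
      by (auto simp: has_real_derivative_iff_has_vector_derivative)
  qed
  then have "norm (w t) powr (2 - p) + (2 - p) * l * t \<le> norm (f - q) powr (2 - p)"
    using flow by (simp only: ww) (simp add: w_def gradient_flow_def)
  moreover have "0 < norm (w t) powr (2 - p)" using w0[of t] t(1) by simp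
  ultimately show False using t(2) by linarith
qed

theorem corollary2p64:
  fixes J :: "'a::{real_inner, complete_space} \<Rightarrow> ereal"
    and p :: real and f :: 'a and u :: "real \<Rightarrow> 'a"
  assumes "1 \<le> p" "p < 2"
    and "abs_homogeneous p J" "proper_fun J" "convex_fun J" "lower_semicontinuous J"
    and "f \<in> closure (eff_dom J)"
    and "gradient_flow J f u"
    and "lambda1 p J > 0"
  shows "extinction_time u
           \<le> ereal (norm (f - flow_limit u) powr (2 - p)) / (ereal (2 - p) * lambda1 p J)
         \<and> ereal (norm (f - flow_limit u) powr (2 - p)) / (ereal (2 - p) * lambda1 p J) < \<infinity>"
proof -
  note J = assms(3,5)
  have nonneg: "0 \<le> J x" for x using abs_homogeneous_nonneg[OF J] .
  obtain q where q: "q \<in> null_space J" "f - q \<in> orthogonal_comp (null_space J)"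
    using hilbert_projection[OF subspace_null_space[OF J] closed_null_space[OF assms(6) nonneg]] .
  define c where "c = norm (f - q) powr (2 - p)"
  have c: "0 \<le> c" by (simp add: c_def)
  have extinct: "u t = q" if "0 < l" "ereal l \<le> lambda1 p J" "c / ((2 - p) * l) \<le> t" for l t
  proof (rule gradient_flow_extinct[OF _ assms(2) J assms(8) q that(2)])
    have "0 \<le> c / ((2 - p) * l)" using c assms(2) that(1) by simp
    then show "0 \<le> t" using that(3) by linarith
    show "norm (f - q) powr (2 - p) \<le> (2 - p) * l * t"
      using that assms(2) by (simp add: c_def pos_divide_le_eq mult.commute)
  qed (use assms(1) in simp)
  obtain l0 where l0: "0 < l0" "ereal l0 \<le> lambda1 p J"
    using ereal_dense2[OF assms(9)] by (auto simp: less_imp_le)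
  have "eventually (\<lambda>t. u t = q) at_top"
    using eventually_ge_at_top[of "c / ((2 - p) * l0)"] by eventually_elim (rule extinct[OF l0])
  then have "(u \<longlongrightarrow> q) at_top" by (rule tendsto_eventually)
  then have lim: "flow_limit u = q"
    unfolding flow_limit_def by (intro tendsto_Lim trivial_limit_at_top_linorder)
  \<comment> \<open>The bound vanishes if \<open>f = q\<close>, but the extinction time only ranges over positive times: hence
    the approximation by later times.\<close>
  have bound: "extinction_time u \<le> ereal (c / ((2 - p) * l))" if l: "0 < l" "ereal l \<le> lambda1 p J" for l
  proof (rule ereal_le_epsilon2)
    fix e :: real assume "0 < e"
    let ?t = "c / ((2 - p) * l) + e"
    have "u ?t = q" using extinct[OF l, of ?t] \<open>0 < e\<close> by simp
    moreover have "0 < ?t" using c l(1) assms(2) \<open>0 < e\<close> by (simp add: add_nonneg_pos)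
    ultimately have "extinction_time u \<le> ereal ?t"
      unfolding extinction_time_def lim by (intro Inf_lower) blast
    then show "extinction_time u \<le> ereal (c / ((2 - p) * l)) + ereal e" by simp
  qed
  show ?thesis
  proof (cases "lambda1 p J")
    case (real l)
    then show ?thesis using bound[of l] assms(2,9) by (auto simp: lim c_def[symmetric])
  next
    case PInf
    have "extinction_time u \<le> ereal 0"
    proof (rule ereal_le_epsilon2)
      fix e :: real assume "0 < e"
      \<comment> \<open>Every real number is a lower bound of \<open>lambda1\<close>; this one makes the time bound at most
        \<open>e\<close>.\<close>
      let ?l = "(c + 1) / ((2 - p) * e)"
      have "0 < ?l" using c assms(2) \<open>0 < e\<close> by simp
      from bound[OF this] have "extinction_time u \<le> ereal (c / ((2 - p) * ?l))" using PInf by simp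
      also have "c / ((2 - p) * ?l) = c / (c + 1) * e" using assms(2) \<open>0 < e\<close> by simp
      also have "\<dots> \<le> 1 * e" using c \<open>0 < e\<close> by (intro mult_right_mono) simp_all
      finally show "extinction_time u \<le> ereal 0 + ereal e" by simp
    qed
    then show ?thesis using PInf assms(2) by (simp flip: zero_ereal_def)
  qed (use assms(9) in simp)
qed

end
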